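(* Let $(R,V)$ be a generalized root system. For a base $S$ of $R$ let $R^+(S)=\{\beta\in R:\beta=\sum_{\alpha\in S}m_\alpha\alpha\text{ with all }m_\alpha\in\mathbb{Z}_{\ge0}\}$. The correspondence $S\longleftrightarrow R^+(S)$ is a bijection between the bases of $R$ and the positive systems of $R$.
   Context: A generalized root system (GRS) is a pair $(R,V)$ where $V$ is a finite-dimensional Euclidean space and $R\subset V$ is a non-empty finite set such that: (i) $V=\operatorname{span} R$; (ii) for all $\alpha,\beta\in R$: if $\langle\alpha,\beta\rangle<0$ then $\alpha+\beta\in R$; if $\langle\alpha,\beta\rangle>0$ then $\alpha-\beta\in R$; if $\langle\alpha,\beta\rangle=0$ then $\alpha+\beta\in R$ if and only if $\alpha-\beta\in R$. (It follows that $0\in R$ and $R=-R$.) A base of $R$ is a subset $S\subset R$ which is a basis of $V$ and such that every $\beta\in R$ can be written $\beta=\sum_{\alpha\in S}m_\alpha\alpha$ with all $m_\alpha\in\mathbb{Z}_{\ge0}$ or all $m_\alpha\in\mathbb{Z}_{\le0}$. A positive system of $R$ is a subset $R^+\subset R$ such that: (1) if $\alpha,\beta\in R^+$ and $\alpha+\beta\in R$ then $\alpha+\beta\in R^+$; (2) $R=R^+\cup(-R^+)$; (3) $R^+\cap(-R^+)=\{0\}$. *)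

theory Defs
  imports "HOL-Analysis.Analysis"
begin

(* V is a subspace of an ambient real inner product space rather than a whole type, so that
   the zero space (with R = {0}) is included: the class euclidean_space has DIM >= 1.
   V is finite-dimensional because it is spanned by the finite set R. *)
definition generalized_root_system :: "'a::real_inner set \<Rightarrow> 'a set \<Rightarrow> bool" where
  "generalized_root_system R V \<longleftrightarrow>
     subspace V \<and> R \<subseteq> V \<and> R \<noteq> {} \<and> finite R \<and> V = span R \<and>
     (\<forall>\<alpha>\<in>R. \<forall>\<beta>\<in>R.
        (\<alpha> \<bullet> \<beta> < 0 \<longrightarrow> \<alpha> + \<beta> \<in> R) \<and>
        (\<alpha> \<bullet> \<beta> > 0 \<longrightarrow> \<alpha> - \<beta> \<in> R) \<and>
        (\<alpha> \<bullet> \<beta> = 0 \<longrightarrow> (\<alpha> + \<beta> \<in> R \<longleftrightarrow> \<alpha> - \<beta> \<in> R)))"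

definition root_base :: "'a::real_inner set \<Rightarrow> 'a set \<Rightarrow> 'a set \<Rightarrow> bool" where
  "root_base R V S \<longleftrightarrow>
     S \<subseteq> R \<and> independent S \<and> span S = V \<and>
     (\<forall>\<beta>\<in>R. \<exists>m :: 'a \<Rightarrow> int.
        \<beta> = (\<Sum>\<alpha>\<in>S. real_of_int (m \<alpha>) *\<^sub>R \<alpha>) \<and>
        ((\<forall>\<alpha>\<in>S. m \<alpha> \<ge> 0) \<or> (\<forall>\<alpha>\<in>S. m \<alpha> \<le> 0)))"

definition positive_system :: "'a::real_inner set \<Rightarrow> 'a set \<Rightarrow> bool" where
  "positive_system R P \<longleftrightarrow>
     P \<subseteq> R \<and>
     (\<forall>\<alpha>\<in>P. \<forall>\<beta>\<in>P. \<alpha> + \<beta> \<in> R \<longrightarrow> \<alpha> + \<beta> \<in> P) \<and>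
     R = P \<union> uminus ` P \<and>
     P \<inter> uminus ` P = {0}"

definition positive_roots :: "'a::real_inner set \<Rightarrow> 'a set \<Rightarrow> 'a set" where
  "positive_roots R S =
     {\<beta> \<in> R. \<exists>m :: 'a \<Rightarrow> int.
        \<beta> = (\<Sum>\<alpha>\<in>S. real_of_int (m \<alpha>) *\<^sub>R \<alpha>) \<and> (\<forall>\<alpha>\<in>S. m \<alpha> \<ge> 0)}"

end

theory Submission
  imports Defs "HOL-Library.Multiset"
begin

text \<open>
  The inverse of \<open>S \<mapsto> R\<^sup>+(S)\<close> sends a positive system \<open>P\<close> to its indecomposable elements, those
  nonzero members of \<open>P\<close> that are not a sum of two nonzero members of \<open>P\<close>.

  That a base \<open>S\<close> is recovered from \<open>R\<^sup>+(S)\<close> is a matter of coefficients. An element of \<open>S\<close> cannot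
  split, since its coefficients sum to one. A positive root \<open>\<beta>\<close> has a positive inner
  product with some \<open>\<alpha> \<in> S\<close> occurring in it, because \<open>\<beta> \<bullet> \<beta> > 0\<close>; hence \<open>\<beta> - \<alpha>\<close> is a root, still with
  nonnegative coefficients, and \<open>\<beta>\<close> splits unless it equals \<open>\<alpha>\<close>.

  Conversely, let \<open>P\<close> be a positive system. Nothing in its definition mentions a linear functional,
  so a substitute for the height is needed. It comes from the fact that a nonempty sum of nonzero
  members of \<open>P\<close> never vanishes (\<open>sum_mset_pos_eq_0\<close>): in a vanishing sum two terms have a negative
  inner product and may be merged into one member of \<open>P\<close>, until a single zero term is left.
  Therefore ``\<open>\<beta>\<close> is obtained from \<open>\<gamma>\<close> by adding nonzero members of \<open>P\<close>'' is a strict order on the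
  finite set \<open>P\<close>. Minimal elements of this order show that \<open>P\<close> lies in the integral cone over its
  indecomposable elements (\<open>pos_in_int_cone\<close>). Maximal elements upgrade the fact about sums from
  integral to real positive coefficients (\<open>no_positive_relation\<close>). Distinct indecomposable elements
  have nonpositive inner products, so a linear relation among them splits into two positive ones,
  and both are trivial (\<open>independent_simple_roots\<close>). This makes the indecomposable elements a
  base, and their integral cone cuts \<open>P\<close> back out of \<open>R\<close>.
\<close>

section \<open>Integral cones and indecomposable elements\<close>

definition int_cone :: "'a::real_vector set \<Rightarrow> 'a set" where
  "int_cone S = {\<beta>. \<exists>m :: 'a \<Rightarrow> int. \<beta> = (\<Sum>\<alpha>\<in>S. real_of_int (m \<alpha>) *\<^sub>R \<alpha>) \<and> (\<forall>\<alpha>\<in>S. m \<alpha> \<ge> 0)}"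

definition simple_roots :: "'a::real_vector set \<Rightarrow> 'a set" where
  "simple_roots P = {\<alpha> \<in> P - {0}. \<not> (\<exists>\<beta>\<in>P - {0}. \<exists>\<gamma>\<in>P - {0}. \<alpha> = \<beta> + \<gamma>)}"

lemma positive_roots_eq_int_cone: "positive_roots R S = R \<inter> int_cone S"
  by (auto simp: positive_roots_def int_cone_def)

lemma int_coneI:
  fixes m :: "'a::real_vector \<Rightarrow> int"
  assumes "x = (\<Sum>\<alpha>\<in>S. real_of_int (m \<alpha>) *\<^sub>R \<alpha>)" "\<forall>\<alpha>\<in>S. m \<alpha> \<ge> 0"
  shows "x \<in> int_cone S"
  unfolding int_cone_def using assms by (intro CollectI exI[of _ m] conjI)

lemma zero_in_int_cone: "0 \<in> int_cone S"
  unfolding int_cone_def by (auto intro: exI[of _ "\<lambda>_. 0"])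

lemma add_in_int_cone:
  assumes "x \<in> int_cone S" "y \<in> int_cone S"
  shows "x + y \<in> int_cone S"
proof -
  obtain m n :: "'a \<Rightarrow> int" where
    "x = (\<Sum>\<alpha>\<in>S. real_of_int (m \<alpha>) *\<^sub>R \<alpha>)" "\<forall>\<alpha>\<in>S. m \<alpha> \<ge> 0"
    "y = (\<Sum>\<alpha>\<in>S. real_of_int (n \<alpha>) *\<^sub>R \<alpha>)" "\<forall>\<alpha>\<in>S. n \<alpha> \<ge> 0"
    using assms unfolding int_cone_def by auto
  then show ?thesis
    unfolding int_cone_def
    by (auto intro!: exI[of _ "\<lambda>\<alpha>. m \<alpha> + n \<alpha>"] simp: scaleR_left_distrib sum.distrib)
qed

lemma sum_indicator_scaleR:
  fixes a :: "'a::real_vector"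
  assumes "finite S" "a \<in> S"
  shows "(\<Sum>\<alpha>\<in>S. real_of_int (if \<alpha> = a then 1 else 0) *\<^sub>R \<alpha>) = a"
proof -
  have "(\<Sum>\<alpha>\<in>S. real_of_int (if \<alpha> = a then 1 else 0) *\<^sub>R \<alpha>) = (\<Sum>\<alpha>\<in>S. if \<alpha> = a then \<alpha> else 0)"
    by (rule sum.cong) auto
  then show ?thesis
    using assms by simp
qed

lemma generator_in_int_cone:
  assumes "finite S" "a \<in> S"
  shows "a \<in> int_cone S"
  unfolding int_cone_def
  by (rule CollectI, rule exI[of _ "\<lambda>\<alpha>. if \<alpha> = a then 1 else 0"])
     (use sum_indicator_scaleR[OF assms] in auto)

lemma int_cone_subset_span: "int_cone S \<subseteq> span S"
  unfolding int_cone_def by (auto intro: span_sum span_scale span_base)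

lemma independent_int_coeffs_unique:
  fixes m n :: "'a::real_vector \<Rightarrow> int"
  assumes "finite S" "independent S"
    and "(\<Sum>\<alpha>\<in>S. real_of_int (m \<alpha>) *\<^sub>R \<alpha>) = (\<Sum>\<alpha>\<in>S. real_of_int (n \<alpha>) *\<^sub>R \<alpha>)"
    and "a \<in> S"
  shows "m a = n a"
proof -
  have "(\<Sum>\<alpha>\<in>S. real_of_int (m \<alpha> - n \<alpha>) *\<^sub>R \<alpha>) = 0"
    using assms(3) by (simp add: scaleR_left_diff_distrib sum_subtractf)
  from independentD[OF assms(2,1) order_refl this assms(4)] show ?thesis
    by simp
qed

text \<open>By independence the coefficients of \<open>x\<close> and \<open>- x\<close> are opposite; being nonnegative, they vanish.
  This is what separates \<open>R\<^sup>+(S)\<close> from its negative.\<close>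

lemma int_cone_pointed:
  assumes S: "finite S" "independent S" and x: "x \<in> int_cone S" "- x \<in> int_cone S"
  shows "x = 0"
proof -
  obtain m n :: "'a \<Rightarrow> int" where m: "x = (\<Sum>\<alpha>\<in>S. real_of_int (m \<alpha>) *\<^sub>R \<alpha>)" "\<forall>\<alpha>\<in>S. m \<alpha> \<ge> 0"
    and n: "- x = (\<Sum>\<alpha>\<in>S. real_of_int (n \<alpha>) *\<^sub>R \<alpha>)" "\<forall>\<alpha>\<in>S. n \<alpha> \<ge> 0"
    using x unfolding int_cone_def by auto
  have "(\<Sum>\<alpha>\<in>S. real_of_int (m \<alpha>) *\<^sub>R \<alpha>) = (\<Sum>\<alpha>\<in>S. real_of_int (- n \<alpha>) *\<^sub>R \<alpha>)"
    using m(1) n(1)[symmetric] by (simp add: sum_negf)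
  then have "m a = - n a" if "a \<in> S" for a
    using independent_int_coeffs_unique[OF S _ that, of m "\<lambda>\<alpha>. - n \<alpha>"] by simp
  then have "m a = 0" if "a \<in> S" for a
    using that m(2) n(2) by force
  then show ?thesis
    using m(1) by simp
qed

section \<open>From a base to its positive system and back\<close>

lemma generalized_root_system_zero:
  assumes "generalized_root_system R V"
  shows "0 \<in> R"
proof -
  obtain a where a: "a \<in> R"
    using assms unfolding generalized_root_system_def by auto
  then have "a \<bullet> a > 0 \<longrightarrow> a - a \<in> R"
    using assms unfolding generalized_root_system_def by blast
  then show ?thesis
    using a by (cases "a = 0") auto
qed

text \<open>The orthogonal case of the axioms, applied to \<open>0\<close> and \<open>a\<close>, is the symmetry of \<open>R\<close>.\<close>

lemma generalized_root_system_uminus: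
  assumes "generalized_root_system R V" "a \<in> R"
  shows "- a \<in> R"
proof -
  have "0 + a \<in> R \<longleftrightarrow> 0 - a \<in> R"
    using assms generalized_root_system_zero[OF assms(1)]
    unfolding generalized_root_system_def by (metis inner_zero_left)
  then show ?thesis
    using assms(2) by simp
qed

lemma root_base_finite:
  assumes "generalized_root_system R V" "root_base R V S"
  shows "finite S"
  using assms unfolding generalized_root_system_def root_base_def
  by (meson finite_subset)

lemma root_base_sign:
  assumes "root_base R V S" "\<beta> \<in> R"
  shows "\<beta> \<in> int_cone S \<or> - \<beta> \<in> int_cone S"
proof -
  obtain m :: "'a \<Rightarrow> int" where m: "\<beta> = (\<Sum>\<alpha>\<in>S. real_of_int (m \<alpha>) *\<^sub>R \<alpha>)"
    "(\<forall>\<alpha>\<in>S. m \<alpha> \<ge> 0) \<or> (\<forall>\<alpha>\<in>S. m \<alpha> \<le> 0)"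
    using assms unfolding root_base_def by blast
  have "- \<beta> = (\<Sum>\<alpha>\<in>S. real_of_int (- m \<alpha>) *\<^sub>R \<alpha>)"
    using m(1) by (simp add: sum_negf)
  moreover have "(\<forall>\<alpha>\<in>S. m \<alpha> \<ge> 0) \<or> (\<forall>\<alpha>\<in>S. - m \<alpha> \<ge> 0)"
    using m(2) by auto
  ultimately show ?thesis
    using m(1) int_coneI[of \<beta> m] int_coneI[of "- \<beta>" "\<lambda>\<alpha>. - m \<alpha>"] by blast
qed

lemma positive_system_positive_roots:
  assumes R: "generalized_root_system R V" and S: "root_base R V S"
  shows "positive_system R (positive_roots R S)"
proof -
  note uminus = generalized_root_system_uminus[OF R]
  have ind: "independent S"
    using S unfolding root_base_def by auto
  note pointed = int_cone_pointed[OF root_base_finite[OF R S] ind]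
  have "R = R \<inter> int_cone S \<union> uminus ` (R \<inter> int_cone S)"
  proof
    show "R \<subseteq> R \<inter> int_cone S \<union> uminus ` (R \<inter> int_cone S)"
      using root_base_sign[OF S] uminus by (force simp: image_iff)
  qed (use uminus in auto)
  moreover have "R \<inter> int_cone S \<inter> uminus ` (R \<inter> int_cone S) = {0}"
    using pointed generalized_root_system_zero[OF R] zero_in_int_cone[of S]
    by (force simp: image_iff)
  ultimately show ?thesis
    unfolding positive_system_def positive_roots_eq_int_cone
    using add_in_int_cone by blast
qed

text \<open>The coefficients of a member of the base sum to one, so in a splitting into two members of the
  cone one summand has all coefficients zero.\<close>

lemma base_int_cone_indecomposable:
  assumes S: "finite S" "independent S" and a: "a \<in> S"
    and b: "b \<in> int_cone S" and c: "c \<in> int_cone S" and abc: "a = b + c"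
  shows "b = 0 \<or> c = 0"
proof -
  obtain m n :: "'a \<Rightarrow> int" where m: "b = (\<Sum>\<alpha>\<in>S. real_of_int (m \<alpha>) *\<^sub>R \<alpha>)" "\<forall>\<alpha>\<in>S. m \<alpha> \<ge> 0"
    and n: "c = (\<Sum>\<alpha>\<in>S. real_of_int (n \<alpha>) *\<^sub>R \<alpha>)" "\<forall>\<alpha>\<in>S. n \<alpha> \<ge> 0"
    using b c unfolding int_cone_def by auto
  define e :: "'a \<Rightarrow> int" where "e = (\<lambda>x. if x = a then 1 else 0)"
  have "(\<Sum>\<alpha>\<in>S. real_of_int (m \<alpha> + n \<alpha>) *\<^sub>R \<alpha>) = (\<Sum>\<alpha>\<in>S. real_of_int (e \<alpha>) *\<^sub>R \<alpha>)"
    using abc m(1) n(1) sum_indicator_scaleR[OF S(1) a]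
    unfolding e_def by (simp add: scaleR_left_distrib sum.distrib)
  then have e: "m x + n x = e x" if "x \<in> S" for x
    using independent_int_coeffs_unique[OF S _ that, of "\<lambda>x. m x + n x" e] by simp
  have off: "m x = 0 \<and> n x = 0" if "x \<in> S" "x \<noteq> a" for x
    using e[OF that(1)] that m(2) n(2) by (force simp: e_def)
  have "m a = 0 \<or> n a = 0"
    using e[OF a] a m(2) n(2) by (force simp: e_def)
  then have "(\<forall>x\<in>S. m x = 0) \<or> (\<forall>x\<in>S. n x = 0)"
    using off by metis
  then show ?thesis
    using m(1) n(1) by auto
qed

text \<open>Some generator \<open>a\<close> occurring in \<open>b\<close> has \<open>b \<bullet> a > 0\<close>, since otherwise \<open>b \<bullet> b \<le> 0\<close>; it can be
  subtracted within both the root system and the cone.\<close>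

lemma int_cone_root_subtract_generator:
  assumes R: "generalized_root_system R V" and S: "finite S" "S \<subseteq> R"
    and b: "b \<in> R" "b \<in> int_cone S" "b \<noteq> 0"
  obtains a where "a \<in> S" "b - a \<in> R" "b - a \<in> int_cone S"
proof -
  obtain m :: "'a \<Rightarrow> int" where m: "b = (\<Sum>\<alpha>\<in>S. real_of_int (m \<alpha>) *\<^sub>R \<alpha>)" "\<forall>\<alpha>\<in>S. m \<alpha> \<ge> 0"
    using b unfolding int_cone_def by auto
  have "b \<bullet> b = (\<Sum>\<alpha>\<in>S. real_of_int (m \<alpha>) * (b \<bullet> \<alpha>))"
    by (subst (2) m(1)) (simp add: inner_sum_right)
  moreover have "b \<bullet> b > 0"
    using b(3) by simp
  ultimately have "\<not> (\<forall>a\<in>S. real_of_int (m a) * (b \<bullet> a) \<le> 0)"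
    using sum_nonpos[of S "\<lambda>a. real_of_int (m a) * (b \<bullet> a)"] by auto
  then obtain a where a: "a \<in> S" "real_of_int (m a) * (b \<bullet> a) > 0"
    by (auto simp: not_le)
  then have ma: "m a > 0" and ba: "b \<bullet> a > 0"
    using m(2) by (auto simp: zero_less_mult_iff order.order_iff_strict)
  have "b - a \<in> R"
    using R S(2) a(1) b(1) ba unfolding generalized_root_system_def by blast
  moreover have "b - a \<in> int_cone S"
  proof -
    define e :: "'a \<Rightarrow> int" where "e = (\<lambda>x. if x = a then 1 else 0)"
    have "b - a = (\<Sum>\<alpha>\<in>S. real_of_int (m \<alpha> - e \<alpha>) *\<^sub>R \<alpha>)"
      using sum_indicator_scaleR[OF S(1) a(1)]
      unfolding e_def by (simp add: scaleR_left_diff_distrib sum_subtractf flip: m(1))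
    moreover have "\<forall>x\<in>S. m x - e x \<ge> 0"
      using m(2) ma by (auto simp: e_def)
    ultimately show ?thesis
      by (rule int_coneI)
  qed
  ultimately show ?thesis
    using that a(1) by blast
qed

lemma simple_roots_positive_roots:
  assumes R: "generalized_root_system R V" and S: "root_base R V S"
  shows "simple_roots (positive_roots R S) = S"
proof
  have fin: "finite S"
    by (rule root_base_finite[OF R S])
  have SR: "S \<subseteq> R" and ind: "independent S"
    using S unfolding root_base_def by auto
  show "S \<subseteq> simple_roots (positive_roots R S)"
  proof
    fix a assume a: "a \<in> S"
    then have "a \<in> positive_roots R S" "a \<noteq> 0"
      using SR generator_in_int_cone[OF fin a] ind dependent_zero
      by (auto simp: positive_roots_eq_int_cone)
    then show "a \<in> simple_roots (positive_roots R S)"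
      using base_int_cone_indecomposable[OF fin ind a]
      unfolding simple_roots_def positive_roots_eq_int_cone by blast
  qed
  show "simple_roots (positive_roots R S) \<subseteq> S"
  proof
    fix b assume b: "b \<in> simple_roots (positive_roots R S)"
    then have "b \<in> R" "b \<in> int_cone S" "b \<noteq> 0"
      by (auto simp: simple_roots_def positive_roots_eq_int_cone)
    from int_cone_root_subtract_generator[OF R fin SR this]
    obtain a where a: "a \<in> S" "b - a \<in> R" "b - a \<in> int_cone S" .
    have "a \<in> positive_roots R S - {0}"
      using a(1) SR generator_in_int_cone[OF fin a(1)] ind dependent_zero
      by (auto simp: positive_roots_eq_int_cone)
    moreover have "b = a + (b - a)" "b - a \<in> positive_roots R S"
      using a by (auto simp: positive_roots_eq_int_cone)
    ultimately have "b - a = 0"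
      using b unfolding simple_roots_def by blast
    then show "b \<in> S"
      using a(1) by simp
  qed
qed

section \<open>The order defined by a positive system\<close>

locale root_system_with_positive_system =
  fixes R V P :: "'a::real_inner set"
  assumes root_system: "generalized_root_system R V"
    and pos_system: "positive_system R P"
begin

lemma finite_P: "finite P" and P_subset: "P \<subseteq> R"
  using root_system pos_system
  unfolding generalized_root_system_def positive_system_def by (auto intro: finite_subset)

lemma zero_in_P: "0 \<in> P"
  using pos_system unfolding positive_system_def by blast

lemma root_sign: "a \<in> R \<Longrightarrow> a \<in> P \<or> - a \<in> P"
  using pos_system unfolding positive_system_def by force

lemma P_pointed: "a \<in> P \<Longrightarrow> - a \<in> P \<Longrightarrow> a = 0"
  using pos_system unfolding positive_system_def by force

lemma P_add_obtuse:
  assumes "a \<in> P - {0}" "b \<in> P - {0}" "a \<bullet> b < 0"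
  shows "a + b \<in> P - {0}"
proof -
  have "a + b \<in> R"
    using assms P_subset root_system unfolding generalized_root_system_def by blast
  then have "a + b \<in> P"
    using assms pos_system unfolding positive_system_def by blast
  moreover have "a + b \<noteq> 0"
    using assms P_pointed[of b] by (auto simp: eq_neg_iff_add_eq_0[symmetric])
  ultimately show ?thesis
    by simp
qed

text \<open>In a vanishing sum, a term \<open>a\<close> has inner product \<open>- (a \<bullet> a) < 0\<close> with the sum of the others,
  hence a negative one with a single other term \<open>b\<close>. Merging \<open>a\<close> and \<open>b\<close> shortens the sum.\<close>

lemma sum_mset_pos_eq_0:
  assumes "set_mset M \<subseteq> P - {0}" "sum_mset M = 0"
  shows "M = {#}"
  using assms
proof (induction "size M" arbitrary: M rule: less_induct)
  case less
  show ?case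
  proof (rule ccontr)
    assume "M \<noteq> {#}"
    then obtain a N where M: "M = add_mset a N"
      by (meson multiset_cases)
    have a: "a \<in> P - {0}" and N: "set_mset N \<subseteq> P - {0}" and sum: "a + sum_mset N = 0"
      using less.prems M by auto
    have inner: "a \<bullet> sum_mset K = (\<Sum>x\<in>#K. a \<bullet> x)" for K
      by (induction K) (auto simp: inner_add_right)
    have "\<exists>b\<in>#N. a \<bullet> b < 0"
    proof (rule ccontr)
      assume "\<not> ?thesis"
      then have "0 \<le> (\<Sum>x\<in>#N. a \<bullet> x)"
        by (induction N) auto
      moreover have "sum_mset N = - a"
        using sum by (simp add: eq_neg_iff_add_eq_0 add.commute)
      ultimately show False
        using a inner[of N] inner_gt_zero_iff[of a] by (simp del: inner_gt_zero_iff)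
    qed
    then obtain b K where b: "a \<bullet> b < 0" and K: "N = add_mset b K"
      by (meson multi_member_split)
    define M' where "M' = add_mset (a + b) K"
    have "a + b \<in> P - {0}"
      using P_add_obtuse a N b K by auto
    then have "M' = {#}"
      using less.hyps[of M'] M K N sum unfolding M'_def by (auto simp: add.assoc)
    then show False
      by (simp add: M'_def)
  qed
qed

definition below :: "'a \<Rightarrow> 'a \<Rightarrow> bool" where
  "below x y \<longleftrightarrow> (\<exists>M. M \<noteq> {#} \<and> set_mset M \<subseteq> P - {0} \<and> y = x + sum_mset M)"

lemma below_trans:
  assumes "below x y" "below y z"
  shows "below x z"
proof -
  obtain M N where "M \<noteq> {#}" "set_mset M \<subseteq> P - {0}" "y = x + sum_mset M"
    "set_mset N \<subseteq> P - {0}" "z = y + sum_mset N"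
    using assms unfolding below_def by blast
  then show ?thesis
    unfolding below_def by (intro exI[of _ "M + N"]) (auto simp: add.assoc)
qed

lemma not_below_self: "\<not> below x x"
  unfolding below_def using sum_mset_pos_eq_0 by auto

lemma transp_below: "transp_on A below"
  by (rule transp_onI) (rule below_trans)

lemma asymp_below: "asymp_on A below"
  by (rule asymp_onI) (metis below_trans not_below_self)

lemma below_add:
  assumes "y \<in> P - {0}"
  shows "below x (x + y)"
  unfolding below_def using assms by (intro exI[of _ "{#y#}"]) auto

section \<open>The base of a positive system\<close>

lemma simple_roots_subset: "simple_roots P \<subseteq> P - {0}"
  by (auto simp: simple_roots_def)

lemma finite_simple_roots: "finite (simple_roots P)"
  using simple_roots_subset finite_P by (meson finite_Diff finite_subset)

text \<open>A minimal member of \<open>P\<close> outside the cone is not simple, so it is a sum of two smaller members of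
  \<open>P\<close>; these lie in the cone, and hence so does their sum.\<close>

lemma pos_in_int_cone: "P \<subseteq> int_cone (simple_roots P)"
proof (rule ccontr)
  assume "\<not> ?thesis"
  then have "P - int_cone (simple_roots P) \<noteq> {}"
    by auto
  from Finite_Set.bex_min_element[OF _ asymp_below transp_below this] finite_P
  obtain b where b: "b \<in> P" "b \<notin> int_cone (simple_roots P)"
    and min: "\<And>x. x \<in> P - int_cone (simple_roots P) \<Longrightarrow> x \<noteq> b \<Longrightarrow> \<not> below x b"
    by auto
  have "b \<noteq> 0" "b \<notin> simple_roots P"
    using b zero_in_int_cone generator_in_int_cone[OF finite_simple_roots] by auto
  then obtain c d where cd: "c \<in> P - {0}" "d \<in> P - {0}" "b = c + d"
    using b(1) unfolding simple_roots_def by blast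
  have "below c b" "below d b"
    using below_add[of d c] below_add[of c d] cd by (auto simp: add.commute)
  then have "c \<in> int_cone (simple_roots P)" "d \<in> int_cone (simple_roots P)"
    using min[of c] min[of d] cd not_below_self by auto
  then show False
    using add_in_int_cone b(2) cd(3) by blast
qed

text \<open>For real coefficients the merging of terms need not terminate. Instead, take a maximal
  element \<open>\<beta>\<close> among the nonzero members of \<open>P\<close> in the span of \<open>T\<close>. Pairing it with the relation shows that either \<open>\<beta> \<bullet> \<alpha> < 0\<close> for some
  \<open>\<alpha> \<in> T\<close>, so that \<open>\<beta> + \<alpha>\<close> is larger, or \<open>\<beta>\<close> is orthogonal to \<open>T\<close> and hence to itself.\<close>

lemma no_positive_relation:
  assumes T: "T \<subseteq> P - {0}" and c: "\<And>\<alpha>. \<alpha> \<in> T \<Longrightarrow> c \<alpha> > 0"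
    and rel: "(\<Sum>\<alpha>\<in>T. c \<alpha> *\<^sub>R \<alpha>) = 0"
  shows "T = {}"
proof (rule ccontr)
  assume "T \<noteq> {}"
  then have "(P - {0}) \<inter> span T \<noteq> {}"
    using T span_base by blast
  from Finite_Set.bex_max_element[OF _ asymp_below transp_below this] finite_P
  obtain b where b: "b \<in> P - {0}" "b \<in> span T"
    and max: "\<And>x. x \<in> P - {0} \<Longrightarrow> x \<in> span T \<Longrightarrow> x \<noteq> b \<Longrightarrow> \<not> below b x"
    by auto
  have nonneg: "b \<bullet> a \<ge> 0" if a: "a \<in> T" for a
  proof (rule ccontr)
    assume "\<not> ?thesis"
    then have "b + a \<in> P - {0}"
      using T a inner_commute by (intro P_add_obtuse b(1)) auto
    moreover have "b + a \<in> span T"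
      using b(2) a by (simp add: span_add span_base)
    ultimately show False
      using max[of "b + a"] below_add[of a b] T a by auto
  qed
  have "finite T"
    using T finite_P by (meson finite_Diff finite_subset)
  moreover have "(\<Sum>\<alpha>\<in>T. c \<alpha> * (b \<bullet> \<alpha>)) = b \<bullet> (\<Sum>\<alpha>\<in>T. c \<alpha> *\<^sub>R \<alpha>)"
    by (simp add: inner_sum_right)
  ultimately have "\<forall>\<alpha>\<in>T. c \<alpha> * (b \<bullet> \<alpha>) = 0"
    using rel nonneg c by (subst sum_nonneg_eq_0_iff[symmetric]) (auto intro: mult_nonneg_nonneg less_imp_le)
  then have "orthogonal b \<alpha>" if "\<alpha> \<in> T" for \<alpha>
    using c that unfolding orthogonal_def by fastforce
  then have "orthogonal b b"
    using orthogonal_to_span[OF b(2)] by blast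
  then show False
    using b(1) by (simp add: orthogonal_def)
qed

text \<open>If \<open>a \<bullet> b > 0\<close>, then \<open>a - b\<close> or \<open>b - a\<close> lies in \<open>P\<close>, and the larger of the two roots splits.\<close>

lemma simple_roots_obtuse:
  assumes a: "a \<in> simple_roots P" and b: "b \<in> simple_roots P" and "a \<noteq> b"
  shows "a \<bullet> b \<le> 0"
proof (rule ccontr)
  assume "\<not> ?thesis"
  moreover have ab: "a \<in> P - {0}" "b \<in> P - {0}"
    using a b simple_roots_subset by auto
  ultimately have "a - b \<in> R"
    using P_subset root_system unfolding generalized_root_system_def not_le by blast
  then have "a - b \<in> P - {0} \<or> b - a \<in> P - {0}"
    using root_sign[of "a - b"] \<open>a \<noteq> b\<close> by auto
  moreover have "a = b + (a - b)" "b = a + (b - a)"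
    by auto
  ultimately show False
    using a b ab unfolding simple_roots_def by blast
qed

text \<open>Moving the negative coefficients of a relation to the other side gives \<open>v = w\<close> for two positive
  combinations of disjoint sets of simple roots. By obtuseness \<open>v \<bullet> w \<le> 0\<close>, so both
  vanish, and a vanishing positive combination of nonzero members of \<open>P\<close> has no terms.\<close>

lemma independent_simple_roots: "independent (simple_roots P)"
proof (rule independent_if_scalars_zero[OF finite_simple_roots])
  fix f :: "'a \<Rightarrow> real" and x
  let ?S = "simple_roots P"
  assume rel: "(\<Sum>a\<in>?S. f a *\<^sub>R a) = 0" and x: "x \<in> ?S"
  define A where "A = {a \<in> ?S. f a > 0}"
  define B where "B = {a \<in> ?S. f a < 0}"
  have fin: "finite A" "finite B"
    using finite_simple_roots by (auto simp: A_def B_def)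
  define v where "v = (\<Sum>a\<in>A. f a *\<^sub>R a)"
  define w where "w = (\<Sum>b\<in>B. (- f b) *\<^sub>R b)"
  have "(\<Sum>a\<in>?S. f a *\<^sub>R a) = (\<Sum>a\<in>A \<union> B. f a *\<^sub>R a)"
    by (rule sum.mono_neutral_right) (auto simp: finite_simple_roots A_def B_def)
  also have "\<dots> = v - w"
    unfolding v_def w_def
    by (subst sum.union_disjoint) (use fin in \<open>auto simp: A_def B_def sum_negf\<close>)
  finally have vw: "v = w"
    using rel by simp
  have "v \<bullet> w = (\<Sum>b\<in>B. \<Sum>a\<in>A. (f a * - f b) * (a \<bullet> b))"
    unfolding v_def w_def by (simp add: inner_sum_left inner_sum_right sum_distrib_left sum_negf algebra_simps)
  also have "\<dots> \<le> 0"
  proof (intro sum_nonpos mult_nonneg_nonpos)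
    fix a b assume ab: "b \<in> B" "a \<in> A"
    then show "f a * - f b \<ge> 0"
      by (intro mult_nonneg_nonneg) (auto simp: A_def B_def)
    show "a \<bullet> b \<le> 0"
      using ab by (intro simple_roots_obtuse) (auto simp: A_def B_def)
  qed
  finally have "v = 0"
    using vw by (metis inner_gt_zero_iff not_le)
  have "A = {}"
  proof (rule no_positive_relation)
    show "A \<subseteq> P - {0}"
      using simple_roots_subset by (auto simp: A_def)
    show "(\<Sum>a\<in>A. f a *\<^sub>R a) = 0"
      using \<open>v = 0\<close> by (simp only: v_def)
  qed (simp add: A_def)
  moreover have "B = {}"
  proof (rule no_positive_relation)
    show "B \<subseteq> P - {0}"
      using simple_roots_subset by (auto simp: B_def)
    show "(\<Sum>b\<in>B. (- f b) *\<^sub>R b) = 0"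
      using \<open>v = 0\<close> vw by (simp only: w_def)
  qed (simp add: B_def)
  ultimately have "\<not> f x > 0" "\<not> f x < 0"
    using x by (auto simp: A_def B_def)
  then show "f x = 0"
    by simp
qed

lemma root_base_simple_roots: "root_base R V (simple_roots P)"
proof -
  let ?S = "simple_roots P"
  have V: "V = span R"
    using root_system unfolding generalized_root_system_def by blast
  have SR: "?S \<subseteq> R"
    using simple_roots_subset P_subset by auto
  have coeffs: "\<exists>m :: 'a \<Rightarrow> int. b = (\<Sum>\<alpha>\<in>?S. real_of_int (m \<alpha>) *\<^sub>R \<alpha>) \<and>
      ((\<forall>\<alpha>\<in>?S. m \<alpha> \<ge> 0) \<or> (\<forall>\<alpha>\<in>?S. m \<alpha> \<le> 0))" if "b \<in> R" for b
    using root_sign[OF that]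
  proof
    assume "b \<in> P"
    then show ?thesis
      using pos_in_int_cone unfolding int_cone_def by blast
  next
    assume "- b \<in> P"
    then obtain m :: "'a \<Rightarrow> int" where "- b = (\<Sum>\<alpha>\<in>?S. real_of_int (m \<alpha>) *\<^sub>R \<alpha>)" "\<forall>\<alpha>\<in>?S. m \<alpha> \<ge> 0"
      using pos_in_int_cone unfolding int_cone_def by blast
    then show ?thesis
      by (intro exI[of _ "\<lambda>\<alpha>. - m \<alpha>"]) (simp add: sum_negf equation_minus_iff[of b])
  qed
  have "R \<subseteq> span ?S"
    using root_sign pos_in_int_cone int_cone_subset_span[of ?S] span_neg[of _ ?S]
    by (metis minus_minus subset_iff)
  then have "span ?S = V"
    using V span_mono[OF SR] span_mono[of R "span ?S"] by (simp add: span_span subset_antisym)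
  then show ?thesis
    unfolding root_base_def using SR independent_simple_roots coeffs by blast
qed

lemma positive_roots_simple_roots: "positive_roots R (simple_roots P) = P"
proof
  show "P \<subseteq> positive_roots R (simple_roots P)"
    using P_subset pos_in_int_cone by (auto simp: positive_roots_eq_int_cone)
  show "positive_roots R (simple_roots P) \<subseteq> P"
  proof
    fix b assume "b \<in> positive_roots R (simple_roots P)"
    then have b: "b \<in> R" "b \<in> int_cone (simple_roots P)"
      by (auto simp: positive_roots_eq_int_cone)
    \<comment> \<open>If instead \<open>- b\<close> lies in \<open>P\<close>, both signs of \<open>b\<close> are in the pointed cone.\<close>
    then have "b \<in> P \<or> b = 0"
      using root_sign pos_in_int_cone
        int_cone_pointed[OF finite_simple_roots independent_simple_roots] by blast
    then show "b \<in> P"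
      using zero_in_P by auto
  qed
qed

end

section \<open>The bijection\<close>

theorem corollary2p5:
  fixes R V :: "'a::real_inner set"
  assumes "generalized_root_system R V"
  shows "bij_betw (positive_roots R) {S. root_base R V S} {P. positive_system R P}"
proof (rule bij_betw_byWitness[where f' = simple_roots])
  show "\<forall>S\<in>{S. root_base R V S}. simple_roots (positive_roots R S) = S"
    using simple_roots_positive_roots[OF assms] by blast
  show "positive_roots R ` {S. root_base R V S} \<subseteq> {P. positive_system R P}"
    using positive_system_positive_roots[OF assms] by blast
  have loc: "root_system_with_positive_system R V P" if "positive_system R P" for P
    using assms that by unfold_locales
  show "\<forall>P\<in>{P. positive_system R P}. positive_roots R (simple_roots P) = P"
    using root_system_with_positive_system.positive_roots_simple_roots[OF loc] by blast
  show "simple_roots ` {P. positive_system R P} \<subseteq> {S. root_base R V S}"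
    using root_system_with_positive_system.root_base_simple_roots[OF loc] by blast
qed

end
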